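(* Let $f:[0,1)\to[0,1)$ be an ergodic measure preserving transformation with respect to the Lebesgue measure $\lambda$ on $[0,1)$. Let $\{b_i\}_{i=1}^{\infty}$ be a decreasing sequence of positive real numbers with $\sum_{i=1}^{\infty} b_i=\infty$. Then for almost every $\alpha\in[0,1)$ and almost every $x\in[0,1)$ (that is, for $\lambda$-almost every $\alpha$, for $\lambda$-almost every $x$), $$\lambda\left(\bigcap_{n=1}^{\infty}\bigcup_{i=n}^{\infty} f^{-i}\big(B(R_\alpha^i x,b_i)\big)\right)=1.$$
   Context: For $\alpha\in[0,1)$, $R_\alpha:[0,1)\to[0,1)$ is the rotation $R_\alpha(x)=x+\alpha-\lfloor x+\alpha\rfloor$. $B(x,r)=\{y\in[0,1):|y-x|<r\}$ is the ball of radius $r$ centered at $x\in[0,1)$. $\lambda$ is Lebesgue measure on $[0,1)$. $f^{-i}(A)$ denotes the preimage of $A$ under the $i$-th iterate $f^i$. *)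

theory Defs
  imports "HOL-Analysis.Analysis"
begin

(* Lebesgue measure on [0,1), on the sigma-algebra of Lebesgue measurable sets
   (i.e. completed, not just Borel). *)
abbreviation lam01 :: "real measure" where
  "lam01 \<equiv> lebesgue_on {0..<1}"

definition rot :: "real \<Rightarrow> real \<Rightarrow> real" where
  "rot \<alpha> x = frac (x + \<alpha>)"

(* Distances are taken in the interval [0,1), not modulo 1. *)
definition ball01 :: "real \<Rightarrow> real \<Rightarrow> real set" where
  "ball01 x r = {y \<in> {0..<1}. \<bar>y - x\<bar> < r}"

definition measure_preserving_map :: "'a measure \<Rightarrow> ('a \<Rightarrow> 'a) \<Rightarrow> bool" where
  "measure_preserving_map M f \<longleftrightarrow>
     f \<in> measurable M M \<and>
     (\<forall>A \<in> sets M. emeasure M (f -` A \<inter> space M) = emeasure M A)"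

definition ergodic_map :: "'a measure \<Rightarrow> ('a \<Rightarrow> 'a) \<Rightarrow> bool" where
  "ergodic_map M f \<longleftrightarrow>
     measure_preserving_map M f \<and>
     (\<forall>A \<in> sets M. f -` A \<inter> space M = A \<longrightarrow>
        emeasure M A = 0 \<or> emeasure M (space M - A) = 0)"

end

(* For fixed y, the points x + i alpha mod 1 with (alpha, x) uniform on the torus are uniform and
   pairwise independent, because (alpha, x) |-> (x + i alpha, x + j alpha) preserves Haar measure
   for i < j. Hence the events |(x + i alpha mod 1) - f^i y| < b_i, whose probabilities are at least
   min b_i (1/2), satisfy the second-moment Borel-Cantelli lemma and a.e. (alpha, x) lies in
   infinitely many of them. Fubini exchanges "every y" for "almost every (alpha, x)". *)
theory Submission
  imports Defs "HOL-Probability.Probability_Measure"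
begin

section \<open>A second-moment Borel-Cantelli lemma\<close>

text \<open>Chebyshev's inequality: over a finite block, the number of events that occur has mean m,
  the sum of their probabilities, and variance at most m. So all of them are missed with probability
  at most 1/m, and divergence makes m arbitrarily large beyond any index.\<close>

lemma (in prob_space) borel_cantelli_quasi_independent:
  fixes E :: "nat \<Rightarrow> 'a set"
  assumes E [measurable]: "\<And>i. E i \<in> events"
    and indep: "\<And>i j. i < j \<Longrightarrow> prob (E i \<inter> E j) \<le> prob (E i) * prob (E j)"
    and div: "\<not> summable (\<lambda>i. prob (E i))"
  shows "AE w in M. \<exists>\<^sub>\<infinity>i. w \<in> E i"
proof -
  \<comment> \<open>The product form of the bound 1/m also covers m = 0.\<close>
  have miss: "prob {w \<in> space M. \<forall>i\<in>I. w \<notin> E i} * (\<Sum>i\<in>I. prob (E i)) \<le> 1"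
    if "finite I" for I
  proof -
    define m where "m = (\<Sum>i\<in>I. prob (E i))"
    define S where "S = (\<lambda>w. \<Sum>i\<in>I. indicator (E i) w :: real)"
    define C where "C = {w \<in> space M. \<forall>i\<in>I. w \<notin> E i}"
    have [measurable]: "C \<in> events"
      unfolding C_def using that by measurable
    have m0: "m \<ge> 0"
      unfolding m_def by (simp add: sum_nonneg)
    have int1: "integrable M (indicator (E i \<inter> E j) :: 'a \<Rightarrow> real)" for i j
      by (simp add: emeasure_eq_measure)
    have int1': "integrable M (indicator (E i) :: 'a \<Rightarrow> real)" for i
      using int1[of i i] by simp
    have sq: "(S w - m)\<^sup>2 =
        (\<Sum>i\<in>I. \<Sum>j\<in>I. indicator (E i \<inter> E j) w) - 2 * m * (\<Sum>i\<in>I. indicator (E i) w) + m\<^sup>2" for w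
      unfolding S_def power2_diff
      by (simp add: power2_eq_square sum_product indicator_inter_arith)
    have intS: "integrable M (\<lambda>w. (S w - m)\<^sup>2)"
      unfolding sq using int1 int1' by (auto intro!: Bochner_Integration.integrable_sum
        Bochner_Integration.integrable_add Bochner_Integration.integrable_diff)
    have "expectation (\<lambda>w. (S w - m)\<^sup>2) =
        (\<Sum>i\<in>I. \<Sum>j\<in>I. prob (E i \<inter> E j)) - 2 * m * m + m\<^sup>2"
      unfolding sq using int1 int1'
      by (simp add: Bochner_Integration.integral_sum m_def prob_space)
    also have "(\<Sum>i\<in>I. \<Sum>j\<in>I. prob (E i \<inter> E j)) \<le>
        (\<Sum>i\<in>I. \<Sum>j\<in>I. prob (E i) * prob (E j) + (if j = i then prob (E i) else 0))"
    proof (intro sum_mono)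
      fix i j :: nat
      consider "i < j" | "j < i" | "i = j" by linarith
      then show "prob (E i \<inter> E j) \<le> prob (E i) * prob (E j) + (if j = i then prob (E i) else 0)"
        by cases (use indep[of i j] indep[of j i] in \<open>auto simp: Int_commute mult.commute\<close>)
    qed
    also have "\<dots> = m * m + m"
      using that by (simp add: sum.distrib m_def sum_product)
    finally have "expectation (\<lambda>w. (S w - m)\<^sup>2) \<le> m"
      by (simp add: power2_eq_square)
    \<comment> \<open>On \<open>C\<close> the count \<open>S\<close> vanishes, so the squared
      deviation there is exactly the square of m.\<close>
    moreover have "expectation (\<lambda>w. m\<^sup>2 * indicator C w) \<le> expectation (\<lambda>w. (S w - m)\<^sup>2)"
    proof (rule integral_mono[OF _ intS])
      show "integrable M (\<lambda>w. m\<^sup>2 * indicator C w)"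
        by (simp add: emeasure_eq_measure)
      show "m\<^sup>2 * indicator C w \<le> (S w - m)\<^sup>2" for w
        by (auto simp: indicator_def C_def S_def)
    qed
    ultimately have "m * (prob C * m) \<le> m * 1"
      by (simp add: power2_eq_square ac_simps)
    then show ?thesis
      using m0 unfolding C_def[symmetric] m_def[symmetric]
      by (cases "m = 0") auto
  qed
  have null: "prob {w \<in> space M. \<forall>i\<ge>n. w \<notin> E i} = 0" for n
  proof (rule ccontr)
    define p where "p = prob {w \<in> space M. \<forall>i\<ge>n. w \<notin> E i}"
    assume "prob {w \<in> space M. \<forall>i\<ge>n. w \<notin> E i} \<noteq> 0"
    then have p: "p > 0"
      unfolding p_def by (simp add: zero_less_measure_iff)
    \<comment> \<open>Missing the whole tail implies missing each finite block of it, so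
      \<open>miss\<close> would bound all partial sums by 1/p and force convergence.\<close>
    have "(\<Sum>i<N. prob (E (i + n))) \<le> 1 / p" for N
    proof -
      have "p \<le> prob {w \<in> space M. \<forall>i\<in>{n..<N+n}. w \<notin> E i}"
        unfolding p_def by (rule finite_measure_mono) auto
      then have "p * (\<Sum>i\<in>{n..<N+n}. prob (E i)) \<le> 1"
        by (intro order_trans[OF mult_right_mono miss[of "{n..<N+n}"]]) (auto simp: sum_nonneg)
      moreover have "(\<Sum>i\<in>{n..<N+n}. prob (E i)) = (\<Sum>i<N. prob (E (i + n)))"
        using sum.shift_bounds_nat_ivl[of "\<lambda>i. prob (E i)" 0 n N] by (simp add: lessThan_atLeast0)
      ultimately show ?thesis
        using p by (simp add: field_simps)
    qed
    then have "summable (\<lambda>i. prob (E (i + n)))"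
      by (intro summableI_nonneg_bounded) auto
    then show False
      using div summable_iff_shift[of "\<lambda>i. prob (E i)" n] by simp
  qed
  have "AE w in M. \<exists>i\<ge>n. w \<in> E i" for n
  proof (rule AE_I)
    show "{w \<in> space M. \<not> (\<exists>i\<ge>n. w \<in> E i)} \<subseteq> {w \<in> space M. \<forall>i\<ge>n. w \<notin> E i}" by auto
    show "emeasure M {w \<in> space M. \<forall>i\<ge>n. w \<notin> E i} = 0"
      using null by (simp add: emeasure_eq_measure)
  qed measurable
  then show ?thesis
    unfolding INFM_nat_le by (simp add: AE_all_countable)
qed

section \<open>Integrals of periodic functions and affine maps of the circle\<close>

text \<open>An integer translation replaces c by its fractional part d. The piece of [d, d+1) beyond
  1 then moves back by one period to [0, d), completing [d, 1) to the unit interval.\<close>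

lemma nn_integral_periodic_shift:
  fixes g :: "real \<Rightarrow> ennreal"
  assumes g [measurable]: "g \<in> borel_measurable borel"
    and per: "\<And>x. g (x + 1) = g x"
  shows "(\<integral>\<^sup>+x. g x * indicator {c..<c+1} x \<partial>lborel) = (\<integral>\<^sup>+x. g x * indicator {0..<1} x \<partial>lborel)"
proof -
  have minus: "g (x - real m) = g x" for m x
  proof (induction m)
    case (Suc m)
    have "x - real (Suc m) + 1 = x - real m" by simp
    then show ?case using per[of "x - real (Suc m)"] Suc by metis
  qed simp
  have plus: "g (x + real m) = g x" for m x
    using minus[of "x + real m" m] by simp
  have per_int: "g (of_int m + x) = g x" for m x
    using plus[of x "nat m"] minus[of x "nat (- m)"] by (cases "m \<ge> 0") (auto simp: add.commute)
  have shift: "(\<integral>\<^sup>+x. g x * indicator {a..<b} x \<partial>lborel) =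
      (\<integral>\<^sup>+x. g x * indicator {a - of_int m..<b - of_int m} x \<partial>lborel)" for a b m
    using nn_integral_real_affine[of "\<lambda>x. g x * indicator {a..<b} x" 1 "of_int m"]
    by (simp add: per_int) (auto intro!: nn_integral_cong simp: indicator_def)
  have split: "(\<integral>\<^sup>+x. g x * indicator {a..<b} x \<partial>lborel) =
      (\<integral>\<^sup>+x. g x * indicator {a..<t} x \<partial>lborel) + (\<integral>\<^sup>+x. g x * indicator {t..<b} x \<partial>lborel)"
    if "a \<le> t" "t \<le> b" for a t b
    using that by (subst nn_integral_add[symmetric])
      (auto intro!: nn_integral_cong simp: indicator_def)
  define d where "d = frac c"
  have d: "0 \<le> d" "d \<le> 1"
    unfolding d_def by (auto simp: frac_lt_1 less_imp_le)
  have "(\<integral>\<^sup>+x. g x * indicator {c..<c+1} x \<partial>lborel) = (\<integral>\<^sup>+x. g x * indicator {d..<d+1} x \<partial>lborel)"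
    by (subst shift[of _ _ "\<lfloor>c\<rfloor>"]) (simp add: d_def frac_def algebra_simps)
  also have "\<dots> = (\<integral>\<^sup>+x. g x * indicator {d..<1} x \<partial>lborel) + (\<integral>\<^sup>+x. g x * indicator {1..<d+1} x \<partial>lborel)"
    using d by (intro split) auto
  also have "(\<integral>\<^sup>+x. g x * indicator {1..<d+1} x \<partial>lborel) = (\<integral>\<^sup>+x. g x * indicator {0..<d} x \<partial>lborel)"
    by (subst shift[of _ _ 1]) simp
  finally show ?thesis
    using split[of 0 d 1] d by (simp add: add.commute)
qed

text \<open>Transfers integrals to \<open>lborel\<close>, where affine substitution is
  available.\<close>

lemma nn_integral_lam01:
  "(\<integral>\<^sup>+x. g x \<partial>lam01) = (\<integral>\<^sup>+x. g x * indicator {0..<1} x \<partial>lborel)"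
  by (simp add: nn_integral_restrict_space nn_integral_completion)

lemma frac_add_one: "frac (x + 1) = frac (x :: real)"
  by (simp add: frac_def)

lemma borel_measurable_frac [measurable]: "(frac :: real \<Rightarrow> real) \<in> borel_measurable borel"
  unfolding frac_def by measurable

text \<open>The map x |-> c + k x wraps the circle k times around itself: its image [c, c + k)
  consists of k full periods, and the Jacobian compensates for the factor k. The case k = 1 is a
  rotation.\<close>

lemma nn_integral_frac_affine:
  fixes g :: "real \<Rightarrow> ennreal"
  assumes g [measurable]: "g \<in> borel_measurable borel" and k: "k > 0"
  shows "(\<integral>\<^sup>+x. g (frac (c + real k * x)) \<partial>lam01) = (\<integral>\<^sup>+x. g x \<partial>lam01)"
proof -
  define I where "I = (\<integral>\<^sup>+x. g x \<partial>lam01)"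
  have I: "(\<integral>\<^sup>+x. g (frac x) * indicator {a..<a+1} x \<partial>lborel) = I" for a
  proof -
    have "(\<integral>\<^sup>+x. g (frac x) * indicator {a..<a+1} x \<partial>lborel) =
        (\<integral>\<^sup>+x. g (frac x) * indicator {0..<1} x \<partial>lborel)"
      by (rule nn_integral_periodic_shift) (simp_all add: frac_add_one)
    also have "\<dots> = I"
      unfolding I_def nn_integral_lam01
      by (intro nn_integral_cong) (auto simp: indicator_def frac_eq)
    finally show ?thesis .
  qed
  have "(\<integral>\<^sup>+x. g (frac x) * indicator {c..<c + real n} x \<partial>lborel) = of_nat n * I" for n
  proof (induction n)
    case (Suc n)
    have "(\<integral>\<^sup>+x. g (frac x) * indicator {c..<c + real (Suc n)} x \<partial>lborel) =
       (\<integral>\<^sup>+x. g (frac x) * indicator {c..<c + real n} x +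
          g (frac x) * indicator {c + real n..<(c + real n) + 1} x \<partial>lborel)"
      by (intro nn_integral_cong) (auto simp: indicator_def)
    also have "\<dots> = of_nat n * I + I"
      by (subst nn_integral_add) (simp_all add: Suc I)
    finally show ?case by (simp add: algebra_simps)
  qed simp
  then have "of_nat k * I = (\<integral>\<^sup>+x. g (frac x) * indicator {c..<c + real k} x \<partial>lborel)" by simp
  also have "\<dots> = of_nat k * (\<integral>\<^sup>+x. g (frac (c + real k * x)) * indicator {c..<c + real k} (c + real k * x) \<partial>lborel)"
    using k by (subst nn_integral_real_affine[where c = "real k" and t = c])
      (auto simp: ennreal_of_nat_eq_real_of_nat)
  also have "(\<integral>\<^sup>+x. g (frac (c + real k * x)) * indicator {c..<c + real k} (c + real k * x) \<partial>lborel) =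
      (\<integral>\<^sup>+x. g (frac (c + real k * x)) \<partial>lam01)"
    unfolding nn_integral_lam01 using k
    by (intro nn_integral_cong) (auto simp: indicator_def zero_le_mult_iff)
  \<comment> \<open>The factor k is finite and nonzero, so it cancels even if the integral
    \<open>I\<close> is infinite.\<close>
  finally show ?thesis
    using k by (simp add: ennreal_mult_cancel_left I_def)
qed

section \<open>Pairwise independence of the points of a random rotation orbit\<close>

interpretation lam01: prob_space lam01
  by standard (simp add: emeasure_restrict_space)

interpretation lam01_pair: pair_prob_space lam01 lam01 ..

lemma borel_measurable_lam01:
  "f \<in> borel_measurable borel \<Longrightarrow> f \<in> borel_measurable lam01"
  by (intro measurable_restrict_space1 measurable_completion) simp

text \<open>Lets \<open>lam01\<close>-valued maps, such as the coordinates of a pair, enter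
  arithmetic expressions as Borel-valued functions.\<close>

lemma ident_borel_measurable_lam01 [measurable]: "(\<lambda>x. x) \<in> borel_measurable lam01"
  by (rule borel_measurable_lam01) simp

text \<open>Here \<open>fst p\<close> is the angle and \<open>snd p\<close> the starting point. For
  a fixed angle, rotating the starting point turns the two orbit points into x and x + k a with k =
  j - i. For fixed x the second is then uniform in the angle a, so the integral factors.\<close>

lemma emeasure_rotation_orbit:
  assumes [measurable]: "A \<in> sets borel" "B \<in> sets borel" and ij: "i < j"
  shows "emeasure (lam01 \<Otimes>\<^sub>M lam01)
      {p \<in> space (lam01 \<Otimes>\<^sub>M lam01). frac (snd p + real i * fst p) \<in> A \<and> frac (snd p + real j * fst p) \<in> B}
    = emeasure lam01 (A \<inter> {0..<1}) * emeasure lam01 (B \<inter> {0..<1})" (is "emeasure _ ?S = _")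
proof -
  define k where "k = j - i"
  have k: "k > 0" "real j = real i + real k" using ij by (auto simp: k_def)
  have ind: "(\<integral>\<^sup>+x. indicator A x \<partial>lam01) = emeasure lam01 (A \<inter> {0..<1})"
    if "A \<in> sets borel" for A :: "real set"
  proof -
    have "(\<integral>\<^sup>+x. indicator A x \<partial>lam01) = (\<integral>\<^sup>+x. indicator (A \<inter> {0..<1}) x \<partial>lam01)"
      by (intro nn_integral_cong) (auto simp: indicator_def)
    then show ?thesis
      using that by (simp add: sets_restrict_space_iff)
  qed
  have "emeasure (lam01 \<Otimes>\<^sub>M lam01) ?S = (\<integral>\<^sup>+p. indicator ?S p \<partial>(lam01 \<Otimes>\<^sub>M lam01))"
    by (rule nn_integral_indicator[symmetric]) measurable
  also have "\<dots> = (\<integral>\<^sup>+p. indicator A (frac (snd p + real i * fst p)) *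
      indicator B (frac (snd p + real j * fst p)) \<partial>(lam01 \<Otimes>\<^sub>M lam01))"
    by (intro nn_integral_cong) (auto simp: indicator_def)
  also have "\<dots> = (\<integral>\<^sup>+a. \<integral>\<^sup>+x. indicator A (frac (x + real i * a)) *
      indicator B (frac (x + real j * a)) \<partial>lam01 \<partial>lam01)"
    by (subst lam01.nn_integral_fst[symmetric]) auto
  also have "\<dots> = (\<integral>\<^sup>+a. \<integral>\<^sup>+x. indicator A x * indicator B (frac (x + real k * a)) \<partial>lam01 \<partial>lam01)"
  proof (rule nn_integral_cong)
    fix a
    have "frac (frac (real i * a + x) + real k * a) = frac (x + real j * a)" for x
      by (simp add: k algebra_simps frac_def)
    then show "(\<integral>\<^sup>+x. indicator A (frac (x + real i * a)) * indicator B (frac (x + real j * a)) \<partial>lam01)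
      = (\<integral>\<^sup>+x. indicator A x * indicator B (frac (x + real k * a)) \<partial>lam01)"
      using nn_integral_frac_affine[of "\<lambda>x. indicator A x * indicator B (frac (x + real k * a))" 1 "real i * a"]
      by (simp add: add.commute)
  qed
  \<comment> \<open>The first factor is now free of the angle, so integrating over the angle first
    isolates the second.\<close>
  also have "\<dots> = (\<integral>\<^sup>+x. \<integral>\<^sup>+a. indicator A x * indicator B (frac (x + real k * a)) \<partial>lam01 \<partial>lam01)"
    by (rule lam01_pair.Fubini'[symmetric]) measurable
  also have "\<dots> = (\<integral>\<^sup>+x. indicator A x * emeasure lam01 (B \<inter> {0..<1}) \<partial>lam01)"
    using nn_integral_frac_affine[of "indicator B" k] k
    by (intro nn_integral_cong) (simp add: nn_integral_cmult ind)
  finally show ?thesis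
    by (simp add: nn_integral_multc ind)
qed

section \<open>Balls in the interval and divergence of their measures\<close>

lemma ball01_sets_borel [measurable]: "ball01 c r \<in> sets borel"
  unfolding ball01_def by measurable

text \<open>A ball near an endpoint may lose one half, but the half pointing to the farther endpoint
  has room for length 1/2. This one-sided piece \<open>J\<close> gives the bound; for nonpositive r
  the minimum is nonpositive.\<close>

lemma measure_ball01_ge:
  assumes "c \<in> {0..<1}"
  shows "min r (1/2) \<le> measure lam01 (ball01 c r)"
proof (cases "r > 0")
  case True
  define s where "s = min r (1/2)"
  have s: "0 < s" "s \<le> r" "s \<le> 1/2" using True by (auto simp: s_def)
  define J where "J = (if c < 1/2 then {c..<c+s} else {c-s<..c})"
  have sub: "J \<subseteq> ball01 c r" "J \<subseteq> {0..<1}" using s assms by (auto simp: J_def ball01_def)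
  have "measure lam01 J = s"
    using s sub by (simp add: measure_restrict_space) (auto simp: J_def)
  moreover have "measure lam01 J \<le> measure lam01 (ball01 c r)"
    by (rule lam01.finite_measure_mono[OF sub(1)]) (auto simp: sets_restrict_space_iff ball01_def)
  ultimately show ?thesis by (simp add: s_def)
qed (auto intro: order_trans[OF _ measure_nonneg])

text \<open>Summable terms tend to 0, so the truncation at e would eventually be inactive and b
  itself summable.\<close>

lemma not_summable_min:
  fixes b :: "nat \<Rightarrow> real"
  assumes "\<not> summable b" "e > 0"
  shows "\<not> summable (\<lambda>i. min (b i) e)"
proof
  assume s: "summable (\<lambda>i. min (b i) e)"
  have "eventually (\<lambda>i. min (b i) e < e) sequentially"
    using order_tendstoD(2)[OF summable_LIMSEQ_zero[OF s] assms(2)] .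
  then have "eventually (\<lambda>i. min (b i) e = b i) sequentially"
    by eventually_elim auto
  then show False
    using s assms(1) summable_cong[of "\<lambda>i. min (b i) e" b] by blast
qed

text \<open>The centers \<open>y i\<close> are deterministic and will be the iterates of one point
  under f; all randomness lies in the angle and the starting point, whose orbit supplies the
  independence.\<close>

lemma AE_rotation_orbit_shrinking_targets:
  fixes b :: "nat \<Rightarrow> real" and y :: "nat \<Rightarrow> real"
  assumes y: "\<And>i. y i \<in> {0..<1}"
    and pos: "\<And>i. 1 \<le> i \<Longrightarrow> 0 < b i" and div: "\<not> summable b"
  shows "AE p in lam01 \<Otimes>\<^sub>M lam01. \<exists>\<^sub>\<infinity>i. frac (snd p + real i * fst p) \<in> ball01 (y i) (b i)"
proof -
  define E where "E = (\<lambda>i. {p \<in> space (lam01 \<Otimes>\<^sub>M lam01). frac (snd p + real i * fst p) \<in> ball01 (y i) (b i)})"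
  have [measurable]: "E i \<in> sets (lam01 \<Otimes>\<^sub>M lam01)" for i
    unfolding E_def by measurable
  have ball: "ball01 c r \<inter> {0..<1} = ball01 c r" for c r
    by (auto simp: ball01_def)
  have prob: "lam01_pair.prob (E i) = measure lam01 (ball01 (y i) (b i))" for i
  proof -
    \<comment> \<open>A trivial second condition makes the joint formula yield the probability of a
      single event.\<close>
    have "E i = {p \<in> space (lam01 \<Otimes>\<^sub>M lam01). frac (snd p + real i * fst p) \<in> ball01 (y i) (b i) \<and>
        frac (snd p + real (Suc i) * fst p) \<in> UNIV}"
      by (auto simp: E_def)
    then have "emeasure (lam01 \<Otimes>\<^sub>M lam01) (E i) = emeasure lam01 (ball01 (y i) (b i))"
      using emeasure_rotation_orbit[of "ball01 (y i) (b i)" UNIV i "Suc i"] lam01.emeasure_space_1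
      by (simp add: ball)
    then show ?thesis by (simp add: measure_def)
  qed
  have "lam01_pair.prob (E i \<inter> E j) = lam01_pair.prob (E i) * lam01_pair.prob (E j)" if "i < j" for i j
  proof -
    have "E i \<inter> E j = {p \<in> space (lam01 \<Otimes>\<^sub>M lam01). frac (snd p + real i * fst p) \<in> ball01 (y i) (b i) \<and>
        frac (snd p + real j * fst p) \<in> ball01 (y j) (b j)}"
      by (auto simp: E_def)
    then have "emeasure (lam01 \<Otimes>\<^sub>M lam01) (E i \<inter> E j) =
        emeasure lam01 (ball01 (y i) (b i)) * emeasure lam01 (ball01 (y j) (b j))"
      using emeasure_rotation_orbit[of "ball01 (y i) (b i)" "ball01 (y j) (b j)" i j] that
      by (simp add: ball)
    then show ?thesis unfolding prob by (simp add: measure_def enn2real_mult)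
  qed
  moreover have "\<not> summable (\<lambda>i. lam01_pair.prob (E i))"
  proof
    assume "summable (\<lambda>i. lam01_pair.prob (E i))"
    then have "summable (\<lambda>i. min (b i) (1/2))"
    proof (rule summable_comparison_test'[where N = 1])
      fix i :: nat assume "1 \<le> i"
      then have "0 < b i" by (rule pos)
      then show "norm (min (b i) (1/2)) \<le> lam01_pair.prob (E i)"
        using measure_ball01_ge[OF y, of "b i" i] by (simp add: prob)
    qed
    then show False
      using not_summable_min[OF div, of "1/2"] by simp
  qed
  ultimately have "AE p in lam01 \<Otimes>\<^sub>M lam01. \<exists>\<^sub>\<infinity>i. p \<in> E i"
    by (intro lam01_pair.borel_cantelli_quasi_independent) auto
  then show ?thesis
    by eventually_elim (auto simp: E_def elim: INFM_mono)
qed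

section \<open>Exchange of quantifiers by Fubini's theorem\<close>

lemma rot_funpow: "x \<in> {0..<1} \<Longrightarrow> (rot \<alpha> ^^ i) x = frac (x + real i * \<alpha>)"
proof (induction i)
  case (Suc i)
  then show ?case
    by (simp add: rot_def) (simp add: frac_def algebra_simps)
qed (simp add: frac_eq)

theorem theorem2p5:
  fixes f :: "real \<Rightarrow> real" and b :: "nat \<Rightarrow> real"
  assumes "ergodic_map lam01 f"
    and "\<And>i. 1 \<le> i \<Longrightarrow> 0 < b i"
    and "\<And>i j. 1 \<le> i \<Longrightarrow> i \<le> j \<Longrightarrow> b j \<le> b i"
    and "filterlim (\<lambda>n. \<Sum>i=1..n. b i) at_top sequentially"
  shows "AE \<alpha> in lam01. AE x in lam01.
           measure lam01
             (\<Inter>n\<in>{1..}. \<Union>i\<in>{n..}.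
                (f ^^ i) -` ball01 ((rot \<alpha> ^^ i) x) (b i) \<inter> {0..<1}) = 1"
proof -
  have [measurable]: "f \<in> measurable lam01 lam01"
    using assms(1) by (simp add: ergodic_map_def measure_preserving_map_def)
  have fi: "f ^^ i \<in> measurable lam01 lam01" for i
    by (induction i) (auto simp: id_def)
  have fi_borel [measurable]: "f ^^ i \<in> borel_measurable lam01" for i
    using measurable_compose[OF fi ident_borel_measurable_lam01] .
  have fi01: "(f ^^ i) y \<in> {0..<1}" if "y \<in> {0..<1}" for i y
    using measurable_space[OF fi, of y i] that by simp
  \<comment> \<open>\<open>summable\<close> counts from index 0 while the hypothesis sums from 1;
    the two differ by the constant \<open>b 0\<close>.\<close>
  have div: "\<not> summable b"
  proof
    assume "summable b"
    then have "(\<lambda>n. (\<Sum>i\<le>n. b i) - b 0) \<longlonglongrightarrow> suminf b - b 0"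
      by (intro tendsto_diff tendsto_const summable_LIMSEQ')
    moreover have "(\<Sum>i\<le>n. b i) - b 0 = (\<Sum>i=1..n. b i)" for n
      by (simp add: atMost_atLeast0 sum.atLeast_Suc_atMost)
    ultimately show False
      using assms(4) not_tendsto_and_filterlim_at_infinity[of sequentially "\<lambda>n. \<Sum>i=1..n. b i"]
      by (auto intro: filterlim_at_top_imp_at_infinity)
  qed
  interpret triple: pair_sigma_finite lam01 "lam01 \<Otimes>\<^sub>M lam01" ..
  \<comment> \<open>The distance is symmetric: \<open>Q\<close> says both that the rotation orbit
    hits the balls around the iterates of y and that these iterates hit the balls around the
    rotation orbit.\<close>
  define Q where "Q = (\<lambda>y p. \<exists>\<^sub>\<infinity>i. \<bar>frac (snd p + real i * fst p) - (f ^^ i) y\<bar> < b i)"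
  have "AE y in lam01. AE p in lam01 \<Otimes>\<^sub>M lam01. Q y p"
  proof (rule AE_I2)
    fix y assume "y \<in> space lam01"
    then have "\<And>i. (f ^^ i) y \<in> {0..<1}" using fi01 by simp
    from AE_rotation_orbit_shrinking_targets[OF this assms(2) div]
    show "AE p in lam01 \<Otimes>\<^sub>M lam01. Q y p"
      unfolding Q_def by (rule AE_mp) (auto simp: ball01_def elim: INFM_mono)
  qed
  \<comment> \<open>Joint measurability in y and p is what permits exchanging the almost-everywhere
    quantifiers.\<close>
  moreover have "{z \<in> space (lam01 \<Otimes>\<^sub>M (lam01 \<Otimes>\<^sub>M lam01)). Q (fst z) (snd z)}
      \<in> sets (lam01 \<Otimes>\<^sub>M (lam01 \<Otimes>\<^sub>M lam01))"
    unfolding Q_def INFM_nat_le by measurable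
  ultimately have "AE p in lam01 \<Otimes>\<^sub>M lam01. AE y in lam01. Q y p"
    using triple.AE_commute[of Q] by simp
  then have "AE \<alpha> in lam01. AE x in lam01. AE y in lam01. Q y (\<alpha>, x)"
    by (rule lam01_pair.AE_pair)
  then show ?thesis
  proof (rule eventually_mono)
    fix \<alpha> assume "AE x in lam01. AE y in lam01. Q y (\<alpha>, x)"
    then show "AE x in lam01. measure lam01 (\<Inter>n\<in>{1..}. \<Union>i\<in>{n..}.
                (f ^^ i) -` ball01 ((rot \<alpha> ^^ i) x) (b i) \<inter> {0..<1}) = 1"
    proof (rule AE_mp, intro AE_I2 impI)
      fix x assume x: "x \<in> space lam01" and Q: "AE y in lam01. Q y (\<alpha>, x)"
      have eq: "(\<Inter>n\<in>{1..}. \<Union>i\<in>{n..}. (f ^^ i) -` ball01 ((rot \<alpha> ^^ i) x) (b i) \<inter> {0..<1})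
          = {y \<in> space lam01. Q y (\<alpha>, x)}" (is "?L = ?R")
      proof -
        have "y \<in> ?L \<longleftrightarrow> y \<in> {0..<1} \<and> (\<forall>n\<ge>1. \<exists>i\<ge>n. \<bar>frac (x + real i * \<alpha>) - (f ^^ i) y\<bar> < b i)" for y
          using x fi01[of y] rot_funpow[where x = x and \<alpha> = \<alpha>]
          by (fastforce simp: ball01_def abs_minus_commute)
        \<comment> \<open>Starting at n = 1 rather than 0 is harmless, since the condition for n = 1
          implies the one for n = 0.\<close>
        moreover have "(\<forall>n\<ge>1. \<exists>i\<ge>n. P i) \<longleftrightarrow> (\<exists>\<^sub>\<infinity>i. P i)" for P :: "nat \<Rightarrow> bool"
          unfolding INFM_nat_le by (metis le_trans nat_le_linear)
        moreover have "space lam01 = {0..<1}" by simp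
        ultimately show ?thesis
          by (simp only: set_eq_iff mem_Collect_eq Q_def fst_conv snd_conv simp_thms)
      qed
      have "?R \<in> sets lam01"
        unfolding Q_def INFM_nat_le by measurable
      then show "measure lam01 ?L = 1"
        unfolding eq by (rule iffD2[OF lam01.prob_Collect_eq_1 Q])
    qed
  qed
qed

end
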